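(* Let $b$ be a connected locally finite weighted graph over $(X,m)$, and let $\kappa$ be its canonical metric, i.e. $\kappa(x,y)=\sup\{\sigma(x,y) \mid \sigma \text{ is an intrinsic pseudo metric with respect to } b \text{ and } m\}$ for $x,y\in X$. The following assertions are equivalent. (i) The canonical metric $\kappa$ is intrinsic with respect to $b$ and $m$. (ii) $b$ is a star graph with a center $p\in X$ such that $$\sum_{x\in X\setminus\{p\}} m(x)\le m(p).$$
   Context: $X$ is a nonempty countable (finite or countably infinite) set and $m\colon X\to(0,\infty)$. A weighted graph on $X$ (or over $(X,m)$) is a symmetric function $b\colon X\times X\to[0,\infty)$ with $b(x,x)=0$ and $\sum_{y\in X}b(x,y)<\infty$ for all $x\in X$. Write $x\sim y$ if $b(x,y)>0$. The graph is locally finite if $\{y\in X\mid y\sim x\}$ is finite for every $x$; it is connected if for all $x,y\in X$ there is a finite sequence $x=x_0\sim x_1\sim\dots\sim x_n=y$ ($n\ge 0$). Let $N(x)=|\{y\in X\mid x\sim y\}|$. A pseudo metric on $X$ is a symmetric function $\sigma\colon X\times X\to[0,\infty)$ with $\sigma(x,x)=0$ satisfying the triangle inequality. It is intrinsic with respect to $b$ and $m$ if $\frac1{m(x)}\sum_{y\in X}b(x,y)\sigma(x,y)^2\le 1$ for every $x\in X$. For connected $b$ the supremum defining $\kappa$ is finite and $\kappa$ is a pseudo metric; for connected locally finite $b$ it is a metric. A star graph is a connected graph for which there exists $p\in X$ with $N(x)=1$ for all $x\in X\setminus\{p\}$; any such $p$ is called a center of $b$. *)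

theory Defs
  imports "HOL-Analysis.Analysis"
begin

text \<open>
  The vertex set is a type of class \<open>countable\<close>, i.e. an arbitrary nonempty set that is finite or
  countably infinite. Sums over possibly infinite vertex sets have nonnegative terms;
  summability together with a bound on \<open>infsum\<close> expresses that the value of the sum in
  \<open>[0,\<infinity>]\<close> obeys that bound (\<open>infsum\<close> of a non-summable real function is \<open>0\<close>).
\<close>

definition weighted_graph :: "('a::countable \<Rightarrow> 'a \<Rightarrow> real) \<Rightarrow> bool" where
  "weighted_graph b \<longleftrightarrow>
     (\<forall>x y. 0 \<le> b x y) \<and> (\<forall>x y. b x y = b y x) \<and> (\<forall>x. b x x = 0) \<and>
     (\<forall>x. (\<lambda>y. b x y) summable_on UNIV)"

definition adjacent :: "('a \<Rightarrow> 'a \<Rightarrow> real) \<Rightarrow> 'a \<Rightarrow> 'a \<Rightarrow> bool" where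
  "adjacent b x y \<longleftrightarrow> b x y > 0"

definition locally_finite :: "('a \<Rightarrow> 'a \<Rightarrow> real) \<Rightarrow> bool" where
  "locally_finite b \<longleftrightarrow> (\<forall>x. finite {y. adjacent b y x})"

definition graph_connected :: "('a \<Rightarrow> 'a \<Rightarrow> real) \<Rightarrow> bool" where
  "graph_connected b \<longleftrightarrow> (\<forall>x y. (adjacent b)\<^sup>*\<^sup>* x y)"

definition num_neighbors :: "('a \<Rightarrow> 'a \<Rightarrow> real) \<Rightarrow> 'a \<Rightarrow> nat" where
  "num_neighbors b x = card {y. adjacent b x y}"

definition pseudo_metric :: "('a \<Rightarrow> 'a \<Rightarrow> real) \<Rightarrow> bool" where
  "pseudo_metric \<sigma> \<longleftrightarrow>
     (\<forall>x y. 0 \<le> \<sigma> x y) \<and> (\<forall>x y. \<sigma> x y = \<sigma> y x) \<and> (\<forall>x. \<sigma> x x = 0) \<and>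
     (\<forall>x y z. \<sigma> x z \<le> \<sigma> x y + \<sigma> y z)"

definition intrinsic ::
    "('a::countable \<Rightarrow> 'a \<Rightarrow> real) \<Rightarrow> ('a \<Rightarrow> real) \<Rightarrow> ('a \<Rightarrow> 'a \<Rightarrow> real) \<Rightarrow> bool" where
  "intrinsic b m \<sigma> \<longleftrightarrow>
     (\<forall>x. (\<lambda>y. b x y * (\<sigma> x y)\<^sup>2) summable_on UNIV \<and>
          1 / m x * (\<Sum>\<^sub>\<infinity>y. b x y * (\<sigma> x y)\<^sup>2) \<le> 1)"

text \<open>
  The supremum is taken in the reals, so the definition is only meaningful when the set is
  nonempty and bounded above; see \<open>canonical_metric_nonempty\<close> and \<open>canonical_metric_bdd\<close>.
\<close>

definition canonical_metric ::
    "('a::countable \<Rightarrow> 'a \<Rightarrow> real) \<Rightarrow> ('a \<Rightarrow> real) \<Rightarrow> 'a \<Rightarrow> 'a \<Rightarrow> real" where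
  "canonical_metric b m x y = Sup {\<sigma> x y |\<sigma>. pseudo_metric \<sigma> \<and> intrinsic b m \<sigma>}"

definition star_center :: "('a \<Rightarrow> 'a \<Rightarrow> real) \<Rightarrow> 'a \<Rightarrow> bool" where
  "star_center b p \<longleftrightarrow> (\<forall>x\<in>UNIV - {p}. num_neighbors b x = 1)"

definition star_graph :: "('a \<Rightarrow> 'a \<Rightarrow> real) \<Rightarrow> bool" where
  "star_graph b \<longleftrightarrow> graph_connected b \<and> (\<exists>p. star_center b p)"

lemma canonical_metric_nonempty:
  "{\<sigma> x y |\<sigma>. pseudo_metric \<sigma> \<and> intrinsic b m \<sigma>} \<noteq> {}"
proof -
  have "pseudo_metric (\<lambda>_ _. 0)" "intrinsic b m (\<lambda>_ _. 0)"
    by (auto simp: pseudo_metric_def intrinsic_def)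
  then show ?thesis by blast
qed

lemma intrinsic_edge_le:
  assumes "weighted_graph b" and "\<And>x. 0 < m x" and "intrinsic b m \<sigma>" and "adjacent b x y"
  shows "\<sigma> x y \<le> sqrt (m x / b x y)"
proof -
  have nn: "0 \<le> b x z * (\<sigma> x z)\<^sup>2" for z
    using assms(1) by (simp add: weighted_graph_def)
  have s: "(\<lambda>z. b x z * (\<sigma> x z)\<^sup>2) summable_on UNIV"
    and le: "1 / m x * (\<Sum>\<^sub>\<infinity>z. b x z * (\<sigma> x z)\<^sup>2) \<le> 1"
    using assms(3) by (auto simp: intrinsic_def)
  have "(\<Sum>z\<in>{y}. b x z * (\<sigma> x z)\<^sup>2) \<le> (\<Sum>\<^sub>\<infinity>z. b x z * (\<sigma> x z)\<^sup>2)"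
    by (rule finite_sum_le_infsum[OF s]) (auto intro: nn)
  also have "\<dots> \<le> m x"
    using le assms(2)[of x] by (simp add: field_simps)
  finally have "(\<sigma> x y)\<^sup>2 \<le> m x / b x y"
    using assms(4) by (simp add: adjacent_def field_simps)
  then show ?thesis by (rule real_le_rsqrt)
qed

lemma canonical_metric_bdd:
  assumes "weighted_graph b" and "\<And>x. 0 < m x" and "graph_connected b"
  shows "bdd_above {\<sigma> x y |\<sigma>. pseudo_metric \<sigma> \<and> intrinsic b m \<sigma>}"
proof -
  have "(adjacent b)\<^sup>*\<^sup>* x y"
    using assms(3) by (simp add: graph_connected_def)
  then have "\<exists>C. \<forall>\<sigma>. pseudo_metric \<sigma> \<and> intrinsic b m \<sigma> \<longrightarrow> \<sigma> x y \<le> C"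
  proof induction
    case base
    show ?case by (auto simp: pseudo_metric_def)
  next
    case (step y z)
    then obtain C where C: "\<And>\<sigma>. pseudo_metric \<sigma> \<Longrightarrow> intrinsic b m \<sigma> \<Longrightarrow> \<sigma> x y \<le> C"
      by blast
    have "\<sigma> x z \<le> C + sqrt (m y / b y z)" if p: "pseudo_metric \<sigma>" and i: "intrinsic b m \<sigma>" for \<sigma>
    proof -
      have "\<sigma> x z \<le> \<sigma> x y + \<sigma> y z" using p by (simp add: pseudo_metric_def)
      with C[OF p i] intrinsic_edge_le[OF assms(1,2) i step.hyps(2)] show ?thesis by linarith
    qed
    then show ?case by blast
  qed
  then show ?thesis by (fastforce simp: bdd_above_def)
qed

end

theory Submission
  imports Defs
begin

text \<open>
  Write \<open>\<kappa>\<close> for the canonical metric.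

  A star with centre \<open>p\<close> has only the edges \<open>{x, p}\<close>, and the intrinsic inequality at the leaf \<open>x\<close>
  reads \<open>b x p * (\<sigma> x p)\<^sup>2 \<le> m x\<close>. This bound passes to the supremum \<open>\<kappa>\<close>, and summing it over the
  leaves gives the inequality for \<open>\<kappa>\<close> at \<open>p\<close> as soon as the leaves weigh no more than \<open>p\<close>.

  For the converse, suppose that \<open>\<kappa>\<close> is intrinsic. It is then the largest intrinsic pseudo metric,
  and this maximality is exploited in two ways.

  First, being intrinsic only concerns the lengths of edges, so a pseudo metric that is at most \<open>\<kappa>\<close>
  on edges is at most \<open>\<kappa>\<close> everywhere (\<open>edge_domination\<close>). Comparison with explicit pseudo metrics
  shows that \<open>\<kappa>\<close> behaves like a path metric: a vertex is at least as far from any other vertex as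
  from its nearest neighbour (\<open>nearest_neighbor_is_nearest\<close>), and every \<open>\<kappa>\<close>-geodesic to a leaf passes
  through the neighbour of that leaf (\<open>dist_to_leaf\<close>).

  Second, for \<open>u \<noteq> x\<close> the function \<open>g = (\<kappa> u - \<kappa> x) / 2\<close> realises \<open>g x - g u = \<kappa> u x\<close>. Raising \<open>g\<close>
  at the single vertex \<open>x\<close> must therefore violate the intrinsic inequality somewhere, which by local
  finiteness forces equality for \<open>g\<close> at \<open>x\<close> or at a neighbour of \<open>x\<close>. Since \<open>g\<close> averages two
  functions that are \<open>1\<close>-Lipschitz for \<open>\<kappa>\<close>, equality at \<open>z\<close> is very restrictive: \<open>\<kappa>\<close> itself has
  equality at \<open>z\<close>, and \<open>z\<close> and all of its neighbours lie on \<open>\<kappa>\<close>-geodesics from \<open>u\<close> to \<open>x\<close>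
  (\<open>tight_vertex\<close>).

  A leaf never lies between two other vertices. Applied to \<open>u\<close> and its nearest neighbour, the
  tight vertex shows that every vertex with at least two neighbours is adjacent to a leaf
  (\<open>non_leaf_has_leaf_neighbor\<close>). Hence, if there are two vertices at all, every vertex is a
  leaf or adjacent to one, so there is no
  tight vertex between two distinct non-leaves (\<open>non_leaf_unique\<close>), and the graph is a star. Finally,
  for a leaf \<open>x\<close> of a centre \<open>p\<close> with several neighbours the tight vertex between \<open>p\<close> and \<open>x\<close> can only
  be \<open>x\<close>, so \<open>b p x * (\<kappa> p x)\<^sup>2 = m x\<close> (\<open>leaf_tight\<close>); the inequality for \<open>\<kappa>\<close> at \<open>p\<close> is then the
  claimed one for \<open>m\<close>. If all vertices are leaves, the graph is a single edge and its heavier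
  endpoint serves as centre.
\<close>


section \<open>Pseudo metrics\<close>

lemma pseudo_metricD:
  assumes "pseudo_metric \<sigma>"
  shows "0 \<le> \<sigma> x y" "\<sigma> x y = \<sigma> y x" "\<sigma> x x = 0" "\<sigma> x z \<le> \<sigma> x y + \<sigma> y z"
  using assms unfolding pseudo_metric_def by blast+

lemma pseudo_metric_abs_diff: "pseudo_metric (\<lambda>u v. \<bar>f u - f v\<bar> :: real)"
  unfolding pseudo_metric_def by auto

definition cut_metric :: "'a \<Rightarrow> real \<Rightarrow> 'a \<Rightarrow> 'a \<Rightarrow> real" where
  "cut_metric x r u v = (if (u = x) = (v = x) then 0 else r)"

lemma pseudo_metric_cut: "0 \<le> r \<Longrightarrow> pseudo_metric (cut_metric x r)"
  unfolding pseudo_metric_def cut_metric_def by auto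

lemma pseudo_metric_max:
  assumes "pseudo_metric \<sigma>" "pseudo_metric \<tau>"
  shows "pseudo_metric (\<lambda>u v. max (\<sigma> u v) (\<tau> u v))"
  unfolding pseudo_metric_def
proof (intro conjI allI)
  fix x y z
  show "max (\<sigma> x z) (\<tau> x z) \<le> max (\<sigma> x y) (\<tau> x y) + max (\<sigma> y z) (\<tau> y z)"
    using pseudo_metricD(4)[OF assms(1), of x z y] pseudo_metricD(4)[OF assms(2), of x z y]
    by linarith
  show "max (\<sigma> x y) (\<tau> x y) = max (\<sigma> y x) (\<tau> y x)"
    using assms pseudo_metricD(2) by metis
qed (simp_all add: le_max_iff_disj assms pseudo_metricD(1,3))

lemma pseudo_metric_add:
  assumes "pseudo_metric \<sigma>" "pseudo_metric \<tau>"
  shows "pseudo_metric (\<lambda>u v. \<sigma> u v + \<tau> u v)"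
  unfolding pseudo_metric_def
proof (intro conjI allI)
  fix x y z
  show "\<sigma> x z + \<tau> x z \<le> (\<sigma> x y + \<tau> x y) + (\<sigma> y z + \<tau> y z)"
    using pseudo_metricD(4)[OF assms(1), of x z y] pseudo_metricD(4)[OF assms(2), of x z y]
    by linarith
  show "\<sigma> x y + \<tau> x y = \<sigma> y x + \<tau> y x"
    using assms pseudo_metricD(2) by metis
qed (simp_all add: assms pseudo_metricD(1,3))

lemma pseudo_metric_pullback:
  assumes "pseudo_metric \<sigma>"
  shows "pseudo_metric (\<lambda>u v. \<sigma> (h u) (h v))"
  using assms unfolding pseudo_metric_def by blast


lemma tendsto_if_zero:
  fixes F :: "real filter"
  assumes "F \<le> nhds 0"
  shows "((\<lambda>r. if P then r else 0) \<longlongrightarrow> 0) F" "((\<lambda>r. if P then 0 else r) \<longlongrightarrow> 0) F"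
proof -
  have "((\<lambda>r. r) \<longlongrightarrow> 0) F"
    using assms by (rule tendsto_mono) (rule filterlim_ident)
  then show "((\<lambda>r. if P then r else 0) \<longlongrightarrow> 0) F" "((\<lambda>r. if P then 0 else r) \<longlongrightarrow> 0) F"
    by (cases P, simp_all)+
qed


section \<open>Locally finite connected graphs and their canonical metric\<close>

locale lf_connected_graph =
  fixes b :: "'a::countable \<Rightarrow> 'a \<Rightarrow> real" and m :: "'a \<Rightarrow> real"
  assumes m_pos: "\<And>x. 0 < m x"
    and graph: "weighted_graph b"
    and loc_fin: "locally_finite b"
    and conn: "graph_connected b"
begin

definition nbrs :: "'a \<Rightarrow> 'a set" where
  "nbrs x = {y. adjacent b x y}"

definition energy :: "('a \<Rightarrow> 'a \<Rightarrow> real) \<Rightarrow> 'a \<Rightarrow> real" where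
  "energy \<sigma> x = (\<Sum>y\<in>nbrs x. b x y * (\<sigma> x y)\<^sup>2)"

abbreviation \<kappa> :: "'a \<Rightarrow> 'a \<Rightarrow> real" where
  "\<kappa> \<equiv> canonical_metric b m"

lemma b_sym: "b x y = b y x" and b_nonneg: "0 \<le> b x y" and b_irrefl: "b x x = 0"
  using graph unfolding weighted_graph_def by blast+

lemma nbrs_iff: "y \<in> nbrs x \<longleftrightarrow> 0 < b x y"
  by (simp add: nbrs_def adjacent_def)

lemma nbrs_sym: "y \<in> nbrs x \<longleftrightarrow> x \<in> nbrs y"
  by (simp add: nbrs_iff b_sym)

lemma nbrs_irrefl: "y \<in> nbrs x \<Longrightarrow> y \<noteq> x"
  using b_irrefl by (auto simp: nbrs_iff)

lemma finite_nbrs: "finite (nbrs x)"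
proof -
  have "nbrs x = {y. adjacent b y x}"
    by (auto simp: nbrs_def adjacent_def b_sym)
  then show ?thesis
    using loc_fin by (simp add: locally_finite_def)
qed

lemma leaf_iff: "num_neighbors b x = 1 \<longleftrightarrow> (\<exists>y. nbrs x = {y})"
  by (simp add: num_neighbors_def nbrs_def card_1_singleton_iff)

lemma nbrs_nonempty:
  assumes "x \<noteq> y"
  shows "nbrs x \<noteq> {}"
proof -
  have "(adjacent b)\<^sup>*\<^sup>* x y"
    using conn by (simp add: graph_connected_def)
  then show ?thesis
    using assms by (cases rule: converse_rtranclpE) (auto simp: nbrs_def)
qed

lemma nbrs_closed_set_contains_all:
  assumes "x \<in> S" and "\<And>u v. u \<in> S \<Longrightarrow> v \<in> nbrs u \<Longrightarrow> v \<in> S"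
  shows "y \<in> S"
proof -
  have "(adjacent b)\<^sup>*\<^sup>* x y"
    using conn by (simp add: graph_connected_def)
  then show ?thesis
    by induction (use assms in \<open>auto simp: nbrs_def\<close>)
qed

lemma nbrs_of_leaf_of_star:
  assumes "star_center b p" "x \<noteq> p"
  shows "nbrs x = {p}"
proof -
  obtain y where y: "nbrs x = {y}"
    using assms leaf_iff unfolding star_center_def by blast
  have "y = p"
  proof (rule ccontr)
    \<comment> \<open>Two adjacent leaves would form a connected component that misses \<open>p\<close>.\<close>
    assume "y \<noteq> p"
    then obtain w where "nbrs y = {w}"
      using assms leaf_iff unfolding star_center_def by blast
    moreover have "x \<in> nbrs y"
      using y nbrs_sym by blast
    ultimately have "nbrs y = {x}"
      by auto
    then have "p \<in> {x, y}"
      using nbrs_closed_set_contains_all[of x "{x, y}" p] y by blast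
    with assms(2) \<open>y \<noteq> p\<close> show False
      by simp
  qed
  with y show ?thesis
    by simp
qed

lemma intrinsic_iff: "intrinsic b m \<sigma> \<longleftrightarrow> (\<forall>x. energy \<sigma> x \<le> m x)"
proof -
  have "((\<lambda>y. b x y * (\<sigma> x y)\<^sup>2) has_sum energy \<sigma> x) UNIV" for x
  proof (subst has_sum_cong_neutral)
    show "((\<lambda>y. b x y * (\<sigma> x y)\<^sup>2) has_sum energy \<sigma> x) (nbrs x)"
      unfolding energy_def by (rule has_sum_finite[OF finite_nbrs])
    show "b x y * (\<sigma> x y)\<^sup>2 = 0" if "y \<in> UNIV - nbrs x" for y
      using that b_nonneg[of x y] by (auto simp: nbrs_iff)
  qed auto
  from has_sum_imp_summable[OF this] infsumI[OF this]
  have "(\<lambda>y. b x y * (\<sigma> x y)\<^sup>2) summable_on UNIV"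
    "(\<Sum>\<^sub>\<infinity>y. b x y * (\<sigma> x y)\<^sup>2) = energy \<sigma> x" for x
    by blast+
  then show ?thesis
    unfolding intrinsic_def using m_pos by (simp add: field_simps)
qed

lemma energy_mono:
  assumes "\<And>y. y \<in> nbrs x \<Longrightarrow> \<bar>\<sigma> x y\<bar> \<le> \<tau> x y"
  shows "energy \<sigma> x \<le> energy \<tau> x"
  unfolding energy_def
proof (intro sum_mono mult_left_mono b_nonneg)
  show "(\<sigma> x y)\<^sup>2 \<le> (\<tau> x y)\<^sup>2" if "y \<in> nbrs x" for y
    using assms[OF that] by (simp add: abs_le_square_iff[symmetric])
qed

lemma energy_eqD:
  assumes le: "\<And>y. y \<in> nbrs x \<Longrightarrow> \<bar>\<sigma> x y\<bar> \<le> \<tau> x y" and eq: "energy \<sigma> x = energy \<tau> x"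
    and y: "y \<in> nbrs x"
  shows "\<bar>\<sigma> x y\<bar> = \<tau> x y"
proof (rule ccontr)
  assume "\<bar>\<sigma> x y\<bar> \<noteq> \<tau> x y"
  then have "\<bar>\<sigma> x y\<bar> < \<bar>\<tau> x y\<bar>"
    using le[OF y] by linarith
  then have lt: "b x y * (\<sigma> x y)\<^sup>2 < b x y * (\<tau> x y)\<^sup>2"
    using y abs_le_square_iff[of "\<tau> x y" "\<sigma> x y"] by (simp add: nbrs_iff)
  have "energy \<sigma> x < energy \<tau> x"
    unfolding energy_def
  proof (rule sum_strict_mono_ex1[OF finite_nbrs])
    show "\<forall>w\<in>nbrs x. b x w * (\<sigma> x w)\<^sup>2 \<le> b x w * (\<tau> x w)\<^sup>2"
      using order_trans[OF le abs_ge_self]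
      by (intro ballI mult_left_mono b_nonneg) (simp add: abs_le_square_iff[symmetric])
    show "\<exists>w\<in>nbrs x. b x w * (\<sigma> x w)\<^sup>2 < b x w * (\<tau> x w)\<^sup>2"
      using lt y by blast
  qed
  with eq show False
    by simp
qed

lemma le_kappa:
  assumes "pseudo_metric \<sigma>" "intrinsic b m \<sigma>"
  shows "\<sigma> x y \<le> \<kappa> x y"
  unfolding canonical_metric_def
  by (rule cSup_upper[OF _ canonical_metric_bdd[OF graph m_pos conn]]) (use assms in blast)

lemma kappa_le:
  assumes "\<And>\<sigma>. pseudo_metric \<sigma> \<Longrightarrow> intrinsic b m \<sigma> \<Longrightarrow> \<sigma> x y \<le> C"
  shows "\<kappa> x y \<le> C"
  unfolding canonical_metric_def
  by (rule cSup_least[OF canonical_metric_nonempty]) (use assms in blast)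

lemma pseudo_metric_kappa: "pseudo_metric \<kappa>"
  unfolding pseudo_metric_def
proof (intro conjI allI)
  fix x y z :: 'a
  have "pseudo_metric (\<lambda>_ _. 0)" "intrinsic b m (\<lambda>_ _. 0)"
    by (auto simp: pseudo_metric_def intrinsic_def)
  then show nonneg: "0 \<le> \<kappa> x y" for x y
    using le_kappa by blast
  have "\<kappa> x y \<le> \<kappa> y x" for x y
    by (rule kappa_le) (metis le_kappa pseudo_metricD(2))
  then show "\<kappa> x y = \<kappa> y x"
    by (simp add: antisym)
  have "\<kappa> x x \<le> 0"
    by (rule kappa_le) (simp add: pseudo_metricD(3))
  then show "\<kappa> x x = 0"
    using nonneg[of x x] by simp
  show "\<kappa> x z \<le> \<kappa> x y + \<kappa> y z"
  proof (rule kappa_le)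
    fix \<sigma> assume *: "pseudo_metric \<sigma>" "intrinsic b m \<sigma>"
    show "\<sigma> x z \<le> \<kappa> x y + \<kappa> y z"
      using le_kappa[OF *, of x y] le_kappa[OF *, of y z] pseudo_metricD(4)[OF *(1), of x z y]
      by linarith
  qed
qed

lemmas kappa = pseudo_metricD[OF pseudo_metric_kappa]

text \<open>
  By local finiteness a small enough multiple of the cut metric of \<open>x\<close> is intrinsic, because only
  the inequalities at \<open>x\<close> and its finitely many neighbours are affected.
\<close>

lemma kappa_pos:
  assumes "x \<noteq> y"
  shows "0 < \<kappa> x y"
proof -
  let ?h = "\<lambda>r z. energy (cut_metric x r) z"
  have away: "?h r z = 0" if "z \<notin> insert x (nbrs x)" for r z
    unfolding energy_def cut_metric_def
    using that nbrs_sym by (intro sum.neutral) auto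
  have "\<forall>\<^sub>F r in at_right 0. \<forall>z\<in>insert x (nbrs x). ?h r z < m z"
  proof (intro eventually_ball_finite ballI)
    fix z
    have "((\<lambda>r. ?h r z) \<longlongrightarrow> ?h 0 z) (at_right 0)"
      unfolding energy_def cut_metric_def
      by (intro tendsto_sum tendsto_mult tendsto_power tendsto_const)
        (simp_all add: tendsto_if_zero at_within_le_nhds)
    moreover have "?h 0 z = 0"
      by (simp add: energy_def cut_metric_def)
    ultimately show "\<forall>\<^sub>F r in at_right 0. ?h r z < m z"
      using m_pos[of z] by (simp add: order_tendstoD(2))
  qed (simp add: finite_nbrs)
  moreover have "\<forall>\<^sub>F r in at_right 0. (0::real) < r"
    by (simp add: eventually_at_right_less)
  ultimately have "\<forall>\<^sub>F r in at_right 0. 0 < r \<and> (\<forall>z\<in>insert x (nbrs x). ?h r z < m z)"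
    by eventually_elim auto
  then obtain r where r: "0 < r" and lt: "\<And>z. z \<in> insert x (nbrs x) \<Longrightarrow> ?h r z < m z"
    using eventually_happens'[OF trivial_limit_at_right_real] by blast
  have "?h r z \<le> m z" for z
    using lt[of z] away[of z r] m_pos[of z] by (cases "z \<in> insert x (nbrs x)") auto
  then have "intrinsic b m (cut_metric x r)"
    by (simp add: intrinsic_iff)
  then have "cut_metric x r x y \<le> \<kappa> x y"
    using le_kappa[OF pseudo_metric_cut] r by simp
  with r assms show ?thesis
    by (simp add: cut_metric_def)
qed


section \<open>Stars with a heavy centre\<close>

lemma star_imp_intrinsic:
  assumes star: "star_center b p" and heavy: "(\<Sum>\<^sub>\<infinity>x\<in>UNIV - {p}. m x) \<le> m p"
  shows "intrinsic b m \<kappa>"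
proof -
  have leaf: "nbrs x = {p}" if "x \<noteq> p" for x
    using nbrs_of_leaf_of_star[OF star that] .
  have nbrs_p: "nbrs p = UNIV - {p}"
    using leaf nbrs_sym nbrs_irrefl by blast
  then have fin: "finite (UNIV - {p})"
    using finite_nbrs[of p] by simp
  have edge: "b x p * (\<kappa> x p)\<^sup>2 \<le> m x" if "x \<noteq> p" for x
  proof -
    have adj: "adjacent b x p"
      using leaf[OF that] by (auto simp: nbrs_def)
    have "\<kappa> x p \<le> sqrt (m x / b x p)"
      by (rule kappa_le) (rule intrinsic_edge_le[OF graph m_pos _ adj])
    then have "(\<kappa> x p)\<^sup>2 \<le> m x / b x p"
      using kappa(1)[of x p] m_pos[of x] b_nonneg[of x p]
      by (metis real_sqrt_le_iff real_sqrt_unique)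
    then show ?thesis
      using adj by (simp add: adjacent_def field_simps)
  qed
  have "energy \<kappa> x \<le> m x" for x
  proof (cases "x = p")
    case True
    have "energy \<kappa> p \<le> (\<Sum>x\<in>nbrs p. m x)"
      unfolding energy_def
    proof (rule sum_mono)
      show "b p x * (\<kappa> p x)\<^sup>2 \<le> m x" if "x \<in> nbrs p" for x
        using edge[of x] nbrs_irrefl[OF that] by (simp add: b_sym[of p x] kappa(2)[of p x])
    qed
    also have "\<dots> = (\<Sum>\<^sub>\<infinity>x\<in>UNIV - {p}. m x)"
      unfolding nbrs_p using fin by (rule infsum_finite[symmetric])
    finally show ?thesis
      using heavy True by simp
  next
    case False
    then show ?thesis
      using edge[OF False] by (simp add: energy_def leaf[OF False])
  qed
  then show ?thesis
    by (simp add: intrinsic_iff)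
qed

end


section \<open>Consequences of an intrinsic canonical metric\<close>

locale intrinsic_kappa = lf_connected_graph +
  assumes intr: "intrinsic b m \<kappa>"
begin

lemma energy_kappa_le: "energy \<kappa> x \<le> m x"
  using intr by (simp add: intrinsic_iff)

lemma edge_domination:
  assumes "pseudo_metric \<tau>" and "\<And>u v. v \<in> nbrs u \<Longrightarrow> \<tau> u v \<le> \<kappa> u v"
  shows "\<tau> x y \<le> \<kappa> x y"
proof (rule le_kappa[OF assms(1)])
  have "energy \<tau> u \<le> m u" for u
    using energy_mono[of u \<tau> \<kappa>] assms(2) energy_kappa_le[of u] pseudo_metricD(1)[OF assms(1)]
    by force
  then show "intrinsic b m \<tau>"
    by (simp add: intrinsic_iff)
qed

text \<open>
  Enlarging all distances from \<open>x\<close> to at least \<open>r\<close> gives a pseudo metric again, and it does not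
  change the length of any edge because no neighbour of \<open>x\<close> is closer than \<open>r\<close>.
\<close>

lemma nearest_neighbor_is_nearest:
  assumes min: "\<And>w. w \<in> nbrs x \<Longrightarrow> r \<le> \<kappa> x w" and "0 \<le> r" "x \<noteq> y"
  shows "r \<le> \<kappa> x y"
proof -
  have "max (\<kappa> x y) (cut_metric x r x y) \<le> \<kappa> x y"
  proof (rule edge_domination[OF pseudo_metric_max[OF pseudo_metric_kappa pseudo_metric_cut]])
    show "max (\<kappa> u v) (cut_metric x r u v) \<le> \<kappa> u v" if "v \<in> nbrs u" for u v
      using that min[of u] min[of v] nbrs_sym[of u v] kappa(1)[of u v] kappa(2)[of u v]
      by (auto simp: cut_metric_def)
  qed (use assms in auto)
  with assms(3) show ?thesis
    by (simp add: cut_metric_def)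
qed

text \<open>
  Folding the leaf \<open>l\<close> onto its neighbour \<open>c\<close> and adding \<open>\<kappa> c l\<close> to all distances from \<open>l\<close> gives a
  pseudo metric that agrees with \<open>\<kappa>\<close> on all edges; the triangle inequality gives the reverse bound.
\<close>

lemma dist_to_leaf:
  assumes leaf: "nbrs l = {c}" and "v \<noteq> l"
  shows "\<kappa> v l = \<kappa> v c + \<kappa> c l"
proof (rule antisym)
  let ?h = "\<lambda>u. if u = l then c else u"
  let ?t = "\<lambda>u v. \<kappa> (?h u) (?h v) + cut_metric l (\<kappa> c l) u v"
  have "?t v l \<le> \<kappa> v l"
  proof (rule edge_domination[where \<tau> = ?t])
    show "pseudo_metric ?t"
      by (rule pseudo_metric_add[OF pseudo_metric_pullback[OF pseudo_metric_kappa]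
            pseudo_metric_cut[OF kappa(1)]])
    show "?t u w \<le> \<kappa> u w" if "w \<in> nbrs u" for u w
    proof -
      have "c \<noteq> l"
        using leaf nbrs_irrefl by blast
      have "w = c" if "u = l"
        using \<open>w \<in> nbrs u\<close> leaf unfolding that by simp
      moreover have "u = c" if "w = l"
        using \<open>w \<in> nbrs u\<close>[unfolded nbrs_sym[of w u]] leaf unfolding that by simp
      ultimately consider "u = l" "w = c" | "w = l" "u = c" | "u \<noteq> l" "w \<noteq> l"
        by argo
      then show ?thesis
        by cases (use \<open>c \<noteq> l\<close> in \<open>simp_all add: cut_metric_def kappa(3) kappa(2)[of l c]\<close>)
    qed
  qed
  with assms(2) show "\<kappa> v c + \<kappa> c l \<le> \<kappa> v l"
    by (simp add: cut_metric_def)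
qed (rule kappa(4))

text \<open>
  If no vertex near \<open>x\<close> had equality for \<open>g = (\<kappa> u - \<kappa> x) / 2\<close>, then \<open>g\<close> could be raised slightly at \<open>x\<close>,
  and the resulting intrinsic pseudo metric \<open>\<bar>g v - g w\<bar>\<close> would exceed \<open>\<kappa> u x\<close>. The averaging makes
  the conclusion symmetric in \<open>u\<close> and \<open>x\<close>: at a vertex of equality both \<open>\<kappa> u\<close> and \<open>-\<kappa> x\<close> must change by
  the full length of each edge, and with the same sign.
\<close>

lemma tight_vertex:
  assumes "u \<noteq> x"
  obtains z where "z \<in> insert x (nbrs x)" "energy \<kappa> z = m z"
    "\<kappa> u z + \<kappa> z x = \<kappa> u x"
    "\<And>w. w \<in> nbrs z \<Longrightarrow> \<kappa> u w + \<kappa> w x = \<kappa> u x"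
proof -
  define g where "g v = (\<kappa> u v - \<kappa> x v) / 2" for v
  define raised where "raised r v = g v + (if v = x then r else 0)" for r v
  define D where "D r v w = \<bar>raised r v - raised r w\<bar>" for r v w
  have D0: "D 0 v w = \<bar>g v - g w\<bar>" for v w
    by (simp add: D_def raised_def)
  have lip: "\<bar>\<kappa> s v - \<kappa> s w\<bar> \<le> \<kappa> v w" for s v w
    using kappa(4)[of s v w] kappa(4)[of s w v] kappa(2)[of v w] by linarith
  have D0_le: "\<bar>D 0 v w\<bar> \<le> \<kappa> v w" for v w
    using lip[of u v w] lip[of x v w] unfolding D0 g_def by argo
  have e0_le: "energy (D 0) z \<le> energy \<kappa> z" for z
    using D0_le by (intro energy_mono)
  have "\<exists>z\<in>insert x (nbrs x). m z \<le> energy (D 0) z"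
  proof (rule ccontr)
    assume "\<not> ?thesis"
    then have lt0: "energy (D 0) z < m z" if "z \<in> insert x (nbrs x)" for z
      using that by force
    have "\<forall>\<^sub>F r in at_right 0. \<forall>z\<in>insert x (nbrs x). energy (D r) z < m z"
    proof (intro eventually_ball_finite ballI)
      fix z assume z: "z \<in> insert x (nbrs x)"
      have "((\<lambda>r. energy (D r) z) \<longlongrightarrow> energy (D 0) z) (at_right 0)"
        unfolding energy_def D_def raised_def
        by (intro tendsto_intros) (simp_all add: tendsto_if_zero at_within_le_nhds)
      then show "\<forall>\<^sub>F r in at_right 0. energy (D r) z < m z"
        using lt0[OF z] by (rule order_tendstoD(2))
    qed (simp add: finite_nbrs)
    moreover have "\<forall>\<^sub>F r in at_right 0. (0::real) < r"
      by (simp add: eventually_at_right_less)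
    ultimately have "\<forall>\<^sub>F r in at_right 0.
        0 < r \<and> (\<forall>z\<in>insert x (nbrs x). energy (D r) z < m z)"
      by eventually_elim auto
    then obtain r where r: "0 < r"
      and lt: "\<And>z. z \<in> insert x (nbrs x) \<Longrightarrow> energy (D r) z < m z"
      using eventually_happens'[OF trivial_limit_at_right_real] by blast
    have "energy (D r) z \<le> m z" for z
    proof (cases "z \<in> insert x (nbrs x)")
      case False
      then have "energy (D r) z = energy (D 0) z"
        unfolding energy_def D_def raised_def
        using nbrs_sym[of x z] by (intro sum.cong) auto
      also have "\<dots> \<le> m z"
        using e0_le energy_kappa_le order_trans by blast
      finally show ?thesis .
    qed (use lt less_imp_le in blast)
    then have "D r u x \<le> \<kappa> u x"
      unfolding D_def by (intro le_kappa pseudo_metric_abs_diff) (simp add: intrinsic_iff D_def)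
    moreover have "D r u x = \<kappa> u x + r"
      unfolding D_def raised_def g_def
      using assms r kappa(1)[of u x] kappa(2)[of u x] kappa(3) by (simp add: field_simps)
    ultimately show False
      using r by simp
  qed
  then obtain z where z: "z \<in> insert x (nbrs x)" and ge: "m z \<le> energy (D 0) z"
    by blast
  have tight: "energy \<kappa> z = m z" and eq: "energy (D 0) z = energy \<kappa> z"
    using ge e0_le[of z] energy_kappa_le[of z] by linarith+
  have level: "\<kappa> u w + \<kappa> w x = \<kappa> u z + \<kappa> z x" if w: "w \<in> nbrs z" for w
  proof -
    have "\<bar>\<bar>g z - g w\<bar>\<bar> = \<kappa> z w"
      using energy_eqD[of z "D 0" \<kappa>, OF D0_le eq w] by (simp add: D0)
    then show ?thesis
      using lip[of u z w] lip[of x z w] kappa(2)[of x z] kappa(2)[of x w]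
      unfolding g_def by argo
  qed
  have zx: "\<kappa> u z + \<kappa> z x = \<kappa> u x"
    using z level[of x] nbrs_sym[of x z] kappa(3) by auto
  show thesis
    using that[OF z tight zx] level zx by simp
qed

text \<open>
  The leaf is the nearest neighbour \<open>x\<close> of \<open>u\<close>. No vertex other than \<open>u\<close> and \<open>x\<close> lies on a
  \<open>\<kappa>\<close>-geodesic between them, so the tight vertex is \<open>u\<close> or \<open>x\<close> and has the other one as its only
  neighbour. It cannot be \<open>u\<close>, which is not a leaf.
\<close>

lemma non_leaf_has_leaf_neighbor:
  assumes "num_neighbors b u \<noteq> 1" and ne: "nbrs u \<noteq> {}"
  obtains x where "nbrs x = {u}"
proof -
  obtain x where x: "x \<in> nbrs u" and min: "\<And>w. w \<in> nbrs u \<Longrightarrow> \<kappa> u x \<le> \<kappa> u w"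
    using arg_min_if_finite(1)[OF finite_nbrs ne] arg_min_least[OF finite_nbrs ne] by metis
  have ux: "u \<noteq> x"
    using nbrs_irrefl[OF x] by simp
  have between: "w = u \<or> w = x" if "\<kappa> u w + \<kappa> w x = \<kappa> u x" for w
  proof (rule ccontr)
    assume "\<not> ?thesis"
    then have "\<kappa> u x \<le> \<kappa> u w" "0 < \<kappa> w x"
      using nearest_neighbor_is_nearest[OF min kappa(1), of w] kappa_pos[of w x] by auto
    with that show False
      by simp
  qed
  obtain z where zx: "\<kappa> u z + \<kappa> z x = \<kappa> u x"
    and w: "\<And>w. w \<in> nbrs z \<Longrightarrow> \<kappa> u w + \<kappa> w x = \<kappa> u x"
    using tight_vertex[OF ux] by metis
  have "nbrs z \<subseteq> {u, x} - {z}"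
    using w between nbrs_irrefl by blast
  with between[OF zx] consider "nbrs u \<subseteq> {x}" | "nbrs x \<subseteq> {u}"
    by blast
  then show thesis
  proof cases
    case 1
    with x have "nbrs u = {x}"
      by blast
    with assms(1) show ?thesis
      using leaf_iff by blast
  next
    case 2
    with x that show ?thesis
      using nbrs_sym by blast
  qed
qed

lemma non_leaf_unique:
  assumes "num_neighbors b u \<noteq> 1" "num_neighbors b x \<noteq> 1"
  shows "u = x"
proof (rule ccontr)
  assume ux: "u \<noteq> x"
  have ne: "nbrs v \<noteq> {}" for v
    using nbrs_nonempty ux by metis
  obtain z where zx: "\<kappa> u z + \<kappa> z x = \<kappa> u x"
    and w: "\<And>w. w \<in> nbrs z \<Longrightarrow> \<kappa> u w + \<kappa> w x = \<kappa> u x"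
    using tight_vertex[OF ux] by metis
  \<comment> \<open>The tight vertex belongs to an edge with an endpoint \<open>l\<close> that is a leaf, and both endpoints lie
    between \<open>u\<close> and \<open>x\<close>.\<close>
  obtain l c where leaf: "nbrs l = {c}" and l: "\<kappa> u l + \<kappa> l x = \<kappa> u x"
    and c: "\<kappa> u c + \<kappa> c x = \<kappa> u x"
  proof (cases "num_neighbors b z = 1")
    case True
    then obtain c where "nbrs z = {c}"
      using leaf_iff by blast
    with that[of z c] zx w show ?thesis
      by simp
  next
    case False
    then obtain l where "nbrs l = {z}"
      using non_leaf_has_leaf_neighbor ne by metis
    with that[of l z] zx w[of l] nbrs_sym show ?thesis
      by blast
  qed
  have "l \<noteq> u" "l \<noteq> x"
    using assms leaf leaf_iff by blast+
  then have "\<kappa> u l = \<kappa> u c + \<kappa> c l" "\<kappa> x l = \<kappa> x c + \<kappa> c l"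
    using dist_to_leaf[OF leaf] by metis+
  moreover have "0 < \<kappa> c l"
    using kappa_pos nbrs_irrefl[of c l] leaf by simp
  ultimately show False
    using l c kappa(2)[of x l] kappa(2)[of x c] by linarith
qed

text \<open>
  The tight vertex between \<open>p\<close> and \<open>x\<close> cannot be \<open>p\<close>, because a second neighbour of \<open>p\<close> does not lie
  between \<open>p\<close> and its leaf \<open>x\<close>.
\<close>

lemma leaf_tight:
  assumes leaf: "nbrs x = {p}" and "num_neighbors b p \<noteq> 1"
  shows "b p x * (\<kappa> p x)\<^sup>2 = m x"
proof -
  have px: "p \<noteq> x" and xp: "x \<in> nbrs p"
    using leaf nbrs_irrefl nbrs_sym by blast+
  obtain y where y: "y \<in> nbrs p" "y \<noteq> x"
    using assms(2) xp leaf_iff by blast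
  obtain z where z: "z \<in> insert x (nbrs x)" and tight: "energy \<kappa> z = m z"
    and w: "\<And>w. w \<in> nbrs z \<Longrightarrow> \<kappa> p w + \<kappa> w x = \<kappa> p x"
    using tight_vertex[OF px] by metis
  have "z \<noteq> p"
  proof
    assume "z = p"
    then have "\<kappa> p y + (\<kappa> y p + \<kappa> p x) = \<kappa> p x"
      using w[of y] y dist_to_leaf[OF leaf, of y] by simp
    moreover have "0 < \<kappa> p y"
      using kappa_pos nbrs_irrefl[OF y(1)] by simp
    ultimately show False
      using kappa(1)[of y p] by linarith
  qed
  then have "z = x"
    using z leaf by simp
  then show ?thesis
    using tight leaf b_sym[of x p] kappa(2)[of x p] by (simp add: energy_def)
qed

lemma intrinsic_imp_star:
  "\<exists>p. star_center b p \<and> m summable_on (UNIV - {p}) \<and> (\<Sum>\<^sub>\<infinity>x\<in>UNIV - {p}. m x) \<le> m p"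
proof (cases "\<exists>p. num_neighbors b p \<noteq> 1")
  case True
  then obtain p where p: "num_neighbors b p \<noteq> 1"
    by blast
  then have star: "star_center b p"
    using non_leaf_unique by (auto simp: star_center_def)
  have leaf: "nbrs x = {p}" if "x \<noteq> p" for x
    using nbrs_of_leaf_of_star[OF star that] .
  have nbrs_p: "nbrs p = UNIV - {p}"
    using leaf nbrs_sym nbrs_irrefl by blast
  then have fin: "finite (UNIV - {p})"
    using finite_nbrs by metis
  have "(\<Sum>\<^sub>\<infinity>x\<in>UNIV - {p}. m x) = energy \<kappa> p"
    unfolding energy_def nbrs_p using fin leaf_tight[OF leaf p] by simp
  then have "(\<Sum>\<^sub>\<infinity>x\<in>UNIV - {p}. m x) \<le> m p"
    using energy_kappa_le[of p] by simp
  with star summable_on_finite[OF fin] show ?thesis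
    by blast
next
  case False
  fix q :: 'a
  obtain r where r: "nbrs q = {r}"
    using False leaf_iff by blast
  have star: "star_center b p" for p
    using False by (simp add: star_center_def)
  have univ: "x = q \<or> x = r" for x
    using nbrs_of_leaf_of_star[OF star, of x q] nbrs_sym r by blast
  have "q \<noteq> r"
    using r nbrs_irrefl by blast
  with univ have "UNIV - {q} = {r}" "UNIV - {r} = {q}"
    by blast+
  then have "m summable_on (UNIV - {q}) \<and> (\<Sum>\<^sub>\<infinity>x\<in>UNIV - {q}. m x) = m r"
    "m summable_on (UNIV - {r}) \<and> (\<Sum>\<^sub>\<infinity>x\<in>UNIV - {r}. m x) = m q"
    by simp_all
  with star[of q] star[of r] show ?thesis
    by (cases "m r \<le> m q") (auto intro: exI[of _ q] exI[of _ r])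
qed

end


section \<open>The characterisation\<close>

theorem theorem3p5:
  fixes b :: "'a::countable \<Rightarrow> 'a \<Rightarrow> real" and m :: "'a \<Rightarrow> real"
  assumes "\<And>x. 0 < m x"
    and "weighted_graph b"
    and "locally_finite b"
    and "graph_connected b"
  shows "intrinsic b m (canonical_metric b m) \<longleftrightarrow>
    star_graph b \<and>
    (\<exists>p. star_center b p \<and> m summable_on (UNIV - {p}) \<and>
         (\<Sum>\<^sub>\<infinity>x\<in>UNIV - {p}. m x) \<le> m p)"
proof -
  interpret lf_connected_graph b m
    by unfold_locales (use assms in auto)
  show ?thesis
  proof
    assume intr: "intrinsic b m (canonical_metric b m)"
    interpret intrinsic_kappa b m
      by unfold_locales (rule intr)
    show "star_graph b \<and> (\<exists>p. star_center b p \<and> m summable_on (UNIV - {p}) \<and>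
        (\<Sum>\<^sub>\<infinity>x\<in>UNIV - {p}. m x) \<le> m p)"
      using intrinsic_imp_star assms(4) by (auto simp: star_graph_def)
  qed (use star_imp_intrinsic in blast)
qed

end
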